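(* Let $\varepsilon>0$, let $n$ be an integer and let $b\leq(1-\varepsilon)\frac n2$. Then in the $(1:b)$ random-Breaker Hamiltonicity game played on $E(K_n)$, Maker has a strategy which is w.h.p.\ a winning strategy, and with it he wins within $(1+o(1))n$ rounds.
   Context: The $(1:b)$ random-Breaker game on the board $E(K_n)$: two players, Maker and Breaker, alternately claim previously unclaimed edges of $K_n$, Breaker moving first. In each round Breaker claims $b$ edges chosen uniformly at random among all unclaimed edges, and then Maker claims one unclaimed edge of his choice (according to a strategy). In the Hamiltonicity game, Maker wins if the graph of his claimed edges contains a Hamilton cycle of $K_n$. "W.h.p." means with probability tending to $1$ as $n\to\infty$. *)

theory Defs
  imports "HOL-Probability.Probability" "HOL-Library.Landau_Symbols"
begin

type_synonym edge = "nat set"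

definition complete_edges :: "nat \<Rightarrow> edge set" where
  "complete_edges n = {e. e \<subseteq> {..<n} \<and> card e = 2}"

definition contains_hamilton_cycle :: "nat \<Rightarrow> edge set \<Rightarrow> bool" where
  "contains_hamilton_cycle n F \<longleftrightarrow>
     n \<ge> 3 \<and>
     (\<exists>vs. distinct vs \<and> set vs = {..<n} \<and>
        (\<forall>i<n. {vs ! i, vs ! (Suc i mod n)} \<in> F))"

text \<open>
  A history lists the completed rounds, oldest first: the set of edges claimed by Breaker in the
  round, followed by Maker's edge. The latter is \<open>None\<close> only if Breaker's move left no unclaimed edge.
\<close>

type_synonym history = "(edge set \<times> edge option) list"

definition breaker_edges :: "history \<Rightarrow> edge set" where
  "breaker_edges h = (\<Union>(B, m) \<in> set h. B)"

definition maker_edges :: "history \<Rightarrow> edge set" where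
  "maker_edges h = {e. \<exists>B. (B, Some e) \<in> set h}"

definition unclaimed :: "nat \<Rightarrow> history \<Rightarrow> edge set" where
  "unclaimed n h = complete_edges n - breaker_edges h - maker_edges h"

text \<open>If fewer than \<open>b\<close> edges are unclaimed, Breaker claims all of them.\<close>

definition breaker_moves :: "nat \<Rightarrow> nat \<Rightarrow> history \<Rightarrow> edge set set" where
  "breaker_moves n b h =
     {B. B \<subseteq> unclaimed n h \<and> card B = min b (card (unclaimed n h))}"

text \<open>
  Maker's next edge, given the completed rounds and Breaker's move in the current round.
\<close>

type_synonym strategy = "history \<Rightarrow> edge set \<Rightarrow> edge"

definition maker_strategy :: "nat \<Rightarrow> strategy \<Rightarrow> bool" where
  "maker_strategy n \<sigma> \<longleftrightarrow>
     (\<forall>h B. unclaimed n h - B \<noteq> {} \<longrightarrow> \<sigma> h B \<in> unclaimed n h - B)"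

definition maker_reply :: "nat \<Rightarrow> strategy \<Rightarrow> history \<Rightarrow> edge set \<Rightarrow> edge option" where
  "maker_reply n \<sigma> h B = (if unclaimed n h - B = {} then None else Some (\<sigma> h B))"

text \<open>
  The distribution of the history after a given number of rounds. Once the board is exhausted, the
  remaining rounds are the empty rounds \<open>({}, None)\<close>.
\<close>

primrec random_breaker_game :: "nat \<Rightarrow> nat \<Rightarrow> strategy \<Rightarrow> nat \<Rightarrow> history pmf" where
  "random_breaker_game n b \<sigma> 0 = return_pmf []"
| "random_breaker_game n b \<sigma> (Suc t) =
     do {
       h \<leftarrow> random_breaker_game n b \<sigma> t;
       B \<leftarrow> pmf_of_set (breaker_moves n b h);
       return_pmf (h @ [(B, maker_reply n \<sigma> h B)])
     }"

definition hamiltonicity_win_prob :: "nat \<Rightarrow> nat \<Rightarrow> strategy \<Rightarrow> nat \<Rightarrow> real" where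
  "hamiltonicity_win_prob n b \<sigma> t =
     measure_pmf.prob (random_breaker_game n b \<sigma> t)
       {h. contains_hamilton_cycle n (maker_edges h)}"

lemma finite_complete_edges: "finite (complete_edges n)"
  by (rule finite_subset[of _ "Pow {..<n}"]) (auto simp: complete_edges_def)

lemma finite_unclaimed: "finite (unclaimed n h)"
  by (simp add: unclaimed_def finite_complete_edges)

lemma finite_breaker_moves: "finite (breaker_moves n b h)"
  by (rule finite_subset[of _ "Pow (unclaimed n h)"])
     (auto simp: breaker_moves_def finite_unclaimed)

lemma breaker_moves_nonempty: "breaker_moves n b h \<noteq> {}"
proof -
  obtain B where "B \<subseteq> unclaimed n h" "card B = min b (card (unclaimed n h))"
    using obtain_subset_with_card_n[of "min b (card (unclaimed n h))" "unclaimed n h"] by auto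
  then show ?thesis by (auto simp: breaker_moves_def)
qed

end

theory Submission
  imports Defs "HOL-Real_Asymp.Real_Asymp"
begin

text \<open>
  The analysis separates randomness from strategy. Let \<open>R\<close> be the set of all edges claimed by Breaker.
  Call \<open>R\<close> good for \<open>k\<close> if the graph of the edges outside \<open>R\<close> has an edge between any two disjoint
  \<open>k\<close>-sets of vertices and has minimum degree above \<open>6k\<close>.

  If \<open>R\<close> is good at the end of the game, then it was good all along, and Maker wins within
  \<open>n + O(k\<^sup>2)\<close> rounds however Breaker plays. Depth-first search, where only forward steps cost a
  round, produces a path missing fewer than \<open>2k\<close> vertices. An edge between its first and its last
  \<open>k\<close> vertices closes a cycle missing fewer than \<open>4k\<close> vertices. A missing vertex \<open>v\<close> is absorbed by
  joining it to \<open>2k\<close> vertices of the cycle and then claiming an edge between the successors of two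
  of these neighbours.

  In the random game a positive fraction of the board stays unclaimed for \<open>n + o(n)\<close> rounds, so
  that a fixed set of \<open>m\<close> edges is swallowed by Breaker with probability at most \<open>q\<^sup>m\<close> for some
  constant \<open>q < 1\<close>. With \<open>k\<close> about \<open>n\<^bsup>1/3\<^esup>\<close> a union bound shows that \<open>R\<close> is good w.h.p.
\<close>

section \<open>Maker's game against an arbitrary Breaker\<close>

text \<open>The degree bound \<open>6 * k\<close> is what absorbing a vertex \<open>v\<close> can
  consume: fewer than \<open>2 * k\<close> neighbours already joined to \<open>v\<close>, at most
  \<open>4 * k\<close> vertices off the cycle, and one excluded cycle vertex.\<close>

definition pseudorandom_complement :: "nat \<Rightarrow> nat \<Rightarrow> edge set \<Rightarrow> bool" where
  "pseudorandom_complement n k R \<longleftrightarrow>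
     (\<forall>A B. A \<subseteq> {..<n} \<longrightarrow> B \<subseteq> {..<n} \<longrightarrow> A \<inter> B = {} \<longrightarrow> card A = k \<longrightarrow> card B = k \<longrightarrow>
        (\<exists>a\<in>A. \<exists>b\<in>B. {a, b} \<notin> R)) \<and>
     (\<forall>v<n. 6 * k < card {x \<in> {..<n} - {v}. {v, x} \<notin> R})"

lemma pseudorandom_complementD:
  assumes "pseudorandom_complement n k R" "A \<subseteq> {..<n}" "B \<subseteq> {..<n}" "A \<inter> B = {}"
    and "k \<le> card A" "k \<le> card B"
  obtains a b where "a \<in> A" "b \<in> B" "{a, b} \<notin> R"
proof -
  obtain A' where A': "A' \<subseteq> A" "card A' = k"
    using obtain_subset_with_card_n[OF assms(5)] by auto
  obtain B' where B': "B' \<subseteq> B" "card B' = k"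
    using obtain_subset_with_card_n[OF assms(6)] by auto
  have "\<exists>a\<in>A'. \<exists>b\<in>B'. {a, b} \<notin> R"
    using assms A' B' unfolding pseudorandom_complement_def
    by (metis (no_types, lifting) inf_mono subset_empty order_trans)
  then show ?thesis using A' B' that by blast
qed

lemma pseudorandom_complement_antimono:
  assumes "pseudorandom_complement n k R'" "R \<subseteq> R'"
  shows "pseudorandom_complement n k R"
proof -
  have "card {x \<in> {..<n} - {v}. {v, x} \<notin> R'} \<le> card {x \<in> {..<n} - {v}. {v, x} \<notin> R}" for v
    using assms(2) by (intro card_mono) auto
  then show ?thesis
    using assms unfolding pseudorandom_complement_def by (smt (verit) order_less_le_trans subsetD)
qed

section \<open>An abstract game against an adversarial Breaker\<close>

lemma contains_hamilton_cycle_mono: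
  "contains_hamilton_cycle n F \<Longrightarrow> F \<subseteq> F' \<Longrightarrow> contains_hamilton_cycle n F'"
  unfolding contains_hamilton_cycle_def by blast

text \<open>A collapse of pseudorandomness counts as success for Maker. This makes the goal monotone
  in both edge sets and leaves Breaker unrestricted in the analysis.\<close>

definition maker_goal :: "nat \<Rightarrow> nat \<Rightarrow> edge set \<Rightarrow> edge set \<Rightarrow> bool" where
  "maker_goal n k F R \<longleftrightarrow> contains_hamilton_cycle n F \<or> \<not> pseudorandom_complement n k R"

lemma maker_goal_mono: "maker_goal n k F R \<Longrightarrow> F \<subseteq> F' \<Longrightarrow> R \<subseteq> R' \<Longrightarrow> maker_goal n k F' R'"
  unfolding maker_goal_def
  using contains_hamilton_cycle_mono pseudorandom_complement_antimono by blast

text \<open>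
  Breaker may claim any number of edges per round and Maker may pass. Passing costs nothing in the
  real game because additional edges never hurt Maker.
\<close>

primrec maker_wins :: "nat \<Rightarrow> nat \<Rightarrow> nat \<Rightarrow> edge set \<Rightarrow> edge set \<Rightarrow> bool" where
  "maker_wins n k 0 F R = maker_goal n k F R"
| "maker_wins n k (Suc j) F R =
     (\<forall>R'. R \<subseteq> R' \<and> R' \<inter> F = {} \<longrightarrow>
        maker_wins n k j F R' \<or> (\<exists>e \<in> complete_edges n - R'. maker_wins n k j (insert e F) R'))"

declare maker_wins.simps(2) [simp del]

lemma maker_wins_SucI:
  assumes "\<And>R'. R \<subseteq> R' \<Longrightarrow> R' \<inter> F = {} \<Longrightarrow>
     maker_wins n k j F R' \<or> (\<exists>e \<in> complete_edges n - R'. maker_wins n k j (insert e F) R')"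
  shows "maker_wins n k (Suc j) F R"
  unfolding maker_wins.simps using assms by (intro allI impI) auto

lemma maker_wins_SucE:
  assumes "maker_wins n k (Suc j) F R" "R \<subseteq> R'" "R' \<inter> F = {}"
  obtains "maker_wins n k j F R'"
    | e where "e \<in> complete_edges n - R'" "maker_wins n k j (insert e F) R'"
  using assms by (auto simp: maker_wins.simps(2))

text \<open>Every Breaker set that can arise from \<open>(F', R')\<close> can also arise from
  \<open>(F, R)\<close>, so Maker copies the reply given there.\<close>

lemma maker_wins_mono:
  "maker_wins n k j F R \<Longrightarrow> F \<subseteq> F' \<Longrightarrow> R \<subseteq> R' \<Longrightarrow> R' \<inter> F' = {} \<Longrightarrow> maker_wins n k j F' R'"
proof (induction j arbitrary: F F' R R')
  case 0
  then show ?case using maker_goal_mono by simp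
next
  case (Suc j)
  show ?case
  proof (rule maker_wins_SucI)
    fix S assume S: "R' \<subseteq> S" "S \<inter> F' = {}"
    then have "R \<subseteq> S" "S \<inter> F = {}" using Suc.prems by auto
    with Suc.prems(1) show "maker_wins n k j F' S \<or>
        (\<exists>e \<in> complete_edges n - S. maker_wins n k j (insert e F') S)"
    proof (cases rule: maker_wins_SucE)
      case 1
      then show ?thesis using Suc.IH[of F S F' S] Suc.prems S by simp
    next
      case (2 e)
      then have "maker_wins n k j (insert e F') S"
        using Suc.IH[of "insert e F" S "insert e F'" S] Suc.prems S by auto
      then show ?thesis using 2 by blast
    qed
  qed
qed

lemma maker_wins_if_goal: "maker_goal n k F R \<Longrightarrow> maker_wins n k j F R"
proof (induction j arbitrary: R)
  case (Suc j)
  then show ?case using maker_goal_mono[of n k F R F] by (intro maker_wins_SucI) blast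
qed simp

text \<open>Maker passes in the additional round; Breaker's extra edges do no harm by
  \<open>maker_wins_mono\<close>.\<close>

lemma maker_wins_Suc: "maker_wins n k j F R \<Longrightarrow> maker_wins n k (Suc j) F R"
  using maker_wins_mono by (auto intro: maker_wins_SucI)

lemma maker_wins_mono_time:
  assumes "j \<le> j'" "maker_wins n k j F R"
  shows "maker_wins n k j' F R"
  using assms by (induction rule: dec_induct) (auto intro: maker_wins_Suc)

text \<open>If Breaker's move destroys pseudorandomness, the goal is already met, so each round may
  be played assuming that the new \<open>R'\<close> is pseudorandom.\<close>

lemma maker_wins_step:
  assumes "\<And>R'. R \<subseteq> R' \<Longrightarrow> R' \<inter> F = {} \<Longrightarrow> pseudorandom_complement n k R' \<Longrightarrow>
     maker_wins n k j F R' \<or> (\<exists>e \<in> complete_edges n - R'. maker_wins n k j (insert e F) R')"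
  shows "maker_wins n k (Suc j) F R"
  using assms maker_wins_if_goal[of n k F _ j] unfolding maker_goal_def
  by (intro maker_wins_SucI) blast

section \<open>From the abstract game to a strategy in the random game\<close>

lemma breaker_edges_snoc: "breaker_edges (h @ [(B, m)]) = breaker_edges h \<union> B"
  by (auto simp: breaker_edges_def)

lemma maker_edges_snoc: "maker_edges (h @ [(B, m)]) = maker_edges h \<union> set_option m"
  by (auto simp: maker_edges_def)

lemma set_pmf_breaker_moves:
  "set_pmf (pmf_of_set (breaker_moves n b h)) = breaker_moves n b h"
  by (simp add: finite_breaker_moves breaker_moves_nonempty)

text \<open>One strategy serves every \<open>b\<close>, since the abstract Breaker may claim
  arbitrarily many edges per round. The goal is met on the whole support, so chance only decides
  whether \<open>breaker_edges h\<close> is pseudorandom.\<close>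

lemma strategy_if_maker_wins:
  assumes "maker_wins n k T {} {}"
  obtains \<sigma> where "maker_strategy n \<sigma>"
    and "\<And>b h. h \<in> set_pmf (random_breaker_game n b \<sigma> T) \<Longrightarrow>
           maker_goal n k (maker_edges h) (breaker_edges h)"
proof -
  \<comment> \<open>The length of the history shows how many of the \<open>T\<close> rounds
    remain.\<close>
  define good where "good h B e \<longleftrightarrow> e \<in> unclaimed n h - B \<and>
    maker_wins n k (T - Suc (length h)) (insert e (maker_edges h)) (breaker_edges h \<union> B)" for h B e
  \<comment> \<open>Without a good edge any free edge is taken. It stands in for a pass and keeps
    \<open>\<sigma>\<close> legal on histories that never arise in play.\<close>
  define \<sigma> :: strategy where
    "\<sigma> h B = (if \<exists>e. good h B e then SOME e. good h B e else SOME e. e \<in> unclaimed n h - B)" for h B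
  have good: "good h B (\<sigma> h B)" if "\<exists>e. good h B e" for h B
    using someI_ex[OF that] that by (simp add: \<sigma>_def)
  have free: "\<sigma> h B \<in> unclaimed n h - B" if "unclaimed n h - B \<noteq> {}" for h B
  proof (cases "\<exists>e. good h B e")
    case True
    then show ?thesis using good[OF True] by (simp add: good_def)
  next
    case False
    then show ?thesis using that by (simp only: \<sigma>_def some_in_eq if_False) simp
  qed
  have inv: "length h = t \<and> breaker_edges h \<inter> maker_edges h = {} \<and>
      maker_wins n k (T - t) (maker_edges h) (breaker_edges h)"
    if "h \<in> set_pmf (random_breaker_game n b \<sigma> t)" "t \<le> T" for b h t
    using that
  proof (induction t arbitrary: h)
    case 0
    then show ?case using assms by (simp add: breaker_edges_def maker_edges_def)
  next
    case (Suc t)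
    then obtain g B where g: "g \<in> set_pmf (random_breaker_game n b \<sigma> t)"
      and B: "B \<in> breaker_moves n b g" and h: "h = g @ [(B, maker_reply n \<sigma> g B)]"
      by (auto simp: set_pmf_breaker_moves)
    let ?F = "maker_edges g" and ?R = "breaker_edges g \<union> B"
    have IH: "length g = t" "breaker_edges g \<inter> ?F = {}"
      "maker_wins n k (T - t) ?F (breaker_edges g)"
      using Suc.IH[OF g] Suc.prems by auto
    have "T - t = Suc (T - Suc t)" using Suc.prems by simp
    with IH(3) have win: "maker_wins n k (Suc (T - Suc t)) ?F (breaker_edges g)" by simp
    have BU: "B \<subseteq> unclaimed n g" using B by (simp add: breaker_moves_def)
    then have disj: "?R \<inter> ?F = {}" using IH(2) by (auto simp: unclaimed_def)
    have alt: "maker_wins n k (T - Suc t) ?F ?R \<or> (\<exists>e. good g B e)"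
      using win Un_upper1 disj
    proof (cases rule: maker_wins_SucE)
      \<comment> \<open>\<open>maker_wins\<close> permits an edge that Maker already owns. Such a
        move amounts to a pass.\<close>
      case (2 e)
      then show ?thesis
        by (cases "e \<in> ?F") (auto simp: good_def IH(1) unclaimed_def insert_absorb)
    qed simp
    show ?case
    proof (cases "unclaimed n g - B = {}")
      \<comment> \<open>On an exhausted board no edge is good, so the pass alternative must
        hold.\<close>
      case True
      then have "maker_wins n k (T - Suc t) ?F ?R" using alt by (auto simp: good_def)
      then show ?thesis using True disj IH(1)
        by (simp add: h breaker_edges_snoc maker_edges_snoc maker_reply_def)
    next
      case False
      have fr: "\<sigma> g B \<in> unclaimed n g - B" using free[OF False] .
      then have disj': "?R \<inter> insert (\<sigma> g B) ?F = {}" using disj by (auto simp: unclaimed_def)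
      have "maker_wins n k (T - Suc t) (insert (\<sigma> g B) ?F) ?R"
      proof (cases "\<exists>e. good g B e")
        case True
        then show ?thesis using good[OF True] by (simp add: good_def IH(1))
      next
        case False
        \<comment> \<open>Here passing wins, and the free edge claimed in its place can only
          help.\<close>
        then show ?thesis using alt maker_wins_mono[OF _ _ _ disj'] by blast
      qed
      then show ?thesis using False disj' IH(1)
        by (simp add: h breaker_edges_snoc maker_edges_snoc maker_reply_def)
    qed
  qed
  show ?thesis
  proof
    show "maker_strategy n \<sigma>" using free by (simp add: maker_strategy_def)
    show "maker_goal n k (maker_edges h) (breaker_edges h)"
      if "h \<in> set_pmf (random_breaker_game n b \<sigma> T)" for b h
      using inv[OF that] by simp
  qed
qed

section \<open>Building a Hamilton cycle\<close>

abbreviation is_path :: "edge set \<Rightarrow> nat list \<Rightarrow> bool" where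
  "is_path F p \<equiv> distinct p \<and> successively (\<lambda>x y. {x, y} \<in> F) p"

definition is_cycle :: "edge set \<Rightarrow> nat list \<Rightarrow> bool" where
  "is_cycle F c \<longleftrightarrow> length c \<ge> 3 \<and> is_path F c \<and> {last c, hd c} \<in> F"

lemma successively_insert:
  "successively (\<lambda>x y. {x, y} \<in> F) p \<Longrightarrow> successively (\<lambda>x y. {x, y} \<in> insert e F) p"
  by (erule successively_mono) simp

lemma is_cycle_mono:
  "is_cycle F c \<Longrightarrow> F \<subseteq> F' \<Longrightarrow> is_cycle F' c"
  unfolding is_cycle_def by (auto elim: successively_mono)

lemma successively_nth: "successively P xs \<Longrightarrow> Suc i < length xs \<Longrightarrow> P (xs ! i) (xs ! Suc i)"
  by (induction P xs arbitrary: i rule: successively.induct) (auto simp: nth_Cons split: nat.splits)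

lemma edge_in_complete_edges: "x < n \<Longrightarrow> y < n \<Longrightarrow> x \<noteq> y \<Longrightarrow> {x, y} \<in> complete_edges n"
  by (simp add: complete_edges_def)

lemma contains_hamilton_cycle_if_is_cycle:
  assumes "is_cycle F c" "set c = {..<n}"
  shows "contains_hamilton_cycle n F"
proof -
  have c: "distinct c" "length c \<ge> 3" "successively (\<lambda>x y. {x, y} \<in> F) c" "{last c, hd c} \<in> F"
    using assms by (auto simp: is_cycle_def)
  have len: "length c = n" using assms(2) distinct_card[OF c(1)] by simp
  have "{c ! i, c ! (Suc i mod n)} \<in> F" if "i < n" for i
  proof (cases "Suc i < n")
    case True
    then show ?thesis using successively_nth[OF c(3), of i] len by simp
  next
    case False
    then have "Suc i = n" using that by simp
    moreover from this have "c ! i = last c" "c ! 0 = hd c"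
      using len c(2) last_conv_nth[of c] hd_conv_nth[of c] by fastforce+
    ultimately show ?thesis using c(4) by simp
  qed
  then show ?thesis using c assms(2) len by (auto simp: contains_hamilton_cycle_def)
qed

text \<open>
  Depth-first search: \<open>U\<close> holds the unvisited vertices, \<open>D\<close> those from which the search has
  backtracked. Every round moves one vertex out of \<open>U\<close>, since backtracking uses up no round.
\<close>

lemma maker_wins_by_path:
  assumes cont: "\<And>p F R. R \<inter> F = {} \<Longrightarrow> is_path F p \<Longrightarrow> set p \<subseteq> {..<n} \<Longrightarrow>
      n < length p + 2 * k \<Longrightarrow> maker_wins n k X F R"
  shows "R \<inter> F = {} \<Longrightarrow> is_path F p \<Longrightarrow> set p \<union> D \<union> U = {..<n} \<Longrightarrow> set p \<inter> U = {} \<Longrightarrow>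
    D \<inter> U = {} \<Longrightarrow> \<forall>d\<in>D. \<forall>u\<in>U. {d, u} \<in> R \<Longrightarrow> card U = k + m \<Longrightarrow> 
    maker_wins n k (m + X) F R"
proof (induction m arbitrary: F R p D U)
  case 0
  show ?case
  proof (cases "pseudorandom_complement n k R")
    case False
    then show ?thesis by (simp add: maker_wins_if_goal maker_goal_def)
  next
    case True
    \<comment> \<open>All pairs between \<open>D\<close> and \<open>U\<close> belong to
      \<open>R\<close> while \<open>card U = k\<close>, so pseudorandomness leaves no room for
      \<open>k\<close> vertices in \<open>D\<close>.\<close>
    have "card D < k"
    proof (rule ccontr)
      assume "\<not> card D < k"
      then obtain a b where "a \<in> D" "b \<in> U" "{a, b} \<notin> R"
        using pseudorandom_complementD[OF True, of D U] 0 by auto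
      then show False using 0 by blast
    qed
    moreover have "n \<le> card (set p) + card D + card U"
    proof -
      have "card (set p \<union> D \<union> U) \<le> card (set p \<union> D) + card U" by (rule card_Un_le)
      also have "card (set p \<union> D) \<le> card (set p) + card D" by (rule card_Un_le)
      finally show ?thesis using 0 by simp
    qed
    moreover have "card (set p) = length p" using 0 by (simp add: distinct_card)
    ultimately have "n < length p + 2 * k" using 0 by simp
    then have "maker_wins n k X F R" using 0 by (intro cont) auto
    then show ?thesis by simp
  qed
next
  case (Suc m)
  have "maker_wins n k (Suc (m + X)) F R"
  proof (rule maker_wins_step)
    fix R' assume R': "R \<subseteq> R'" "R' \<inter> F = {}" "pseudorandom_complement n k R'"
    \<comment> \<open>The head of \<open>p\<close> is the active end of the search. The prefix
      \<open>q\<close> of vertices whose edges into \<open>U\<close> are now all Breaker's is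
      abandoned at once.\<close>
    define P where "P x \<longleftrightarrow> (\<forall>u\<in>U. {x, u} \<in> R')" for x
    define q where "q = takeWhile P p"
    define p' where "p' = dropWhile P p"
    have pq: "p = q @ p'" by (simp add: p'_def q_def)
    have D': "\<forall>d\<in>D \<union> set q. \<forall>u\<in>U. {d, u} \<in> R'"
      using Suc.prems R' set_takeWhileD[of _ P p] by (auto simp: q_def P_def)
    have path: "is_path F p'" using Suc.prems by (auto simp: pq successively_append_iff)
    have finU: "finite U" using Suc.prems by (intro card_ge_0_finite) simp
    have U: "set p' \<union> (D \<union> set q) \<union> U = {..<n}" "(set p' \<union> (D \<union> set q)) \<inter> U = {}"
      using Suc.prems by (auto simp: pq)
    have cardU: "card (U - {u}) = k + m" if "u \<in> U" for u
      using Suc.prems finU that by simp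
    show "maker_wins n k (m + X) F R' \<or>
          (\<exists>e\<in>complete_edges n - R'. maker_wins n k (m + X) (insert e F) R')"
    proof (cases p')
      \<comment> \<open>With the path used up, the search restarts at any unvisited vertex, and
        Maker passes in this round.\<close>
      case Nil
      obtain u where u: "u \<in> U" using Suc.prems by fastforce
      have "maker_wins n k (m + X) F R'"
        by (rule Suc.IH[of _ _ "[u]" "D \<union> set q" "U - {u}"])
           (use Nil U D' R' u cardU in auto)
      then show ?thesis ..
    next
      case (Cons x xs)
      then have "\<not> P x" using hd_dropWhile[of P p] by (simp add: p'_def)
      then obtain u where u: "u \<in> U" "{x, u} \<notin> R'" by (auto simp: P_def)
      have xu: "x < n" "u < n" "x \<noteq> u" using U u Cons by auto
      have "maker_wins n k (m + X) (insert {x, u} F) R'"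
      proof (rule Suc.IH[of _ _ "u # p'" "D \<union> set q" "U - {u}"])
        show "is_path (insert {x, u} F) (u # p')"
          using path successively_insert[of F p' "{x, u}"] U u Cons
          by (auto simp: successively_Cons insert_commute)
      qed (use U D' R' u cardU in auto)
      then show ?thesis using u xu edge_in_complete_edges[of x n u] by blast
    qed
  qed
  then show ?case by simp
qed

text \<open>\<open>cont\<close> is the next phase, to be won in \<open>X\<close> further rounds; the
  phases are composed in this way. The bound \<open>4 * k + 2 \<le> n\<close> keeps the two end
  segments of the path disjoint and the cycle long enough.\<close>

lemma maker_wins_by_cycle:
  assumes cont: "\<And>c F R. R \<inter> F = {} \<Longrightarrow> is_cycle F c \<Longrightarrow> set c \<subseteq> {..<n} \<Longrightarrow>
      n < length c + 4 * k \<Longrightarrow> maker_wins n k X F R"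
    and n: "4 * k + 2 \<le> n" and "is_path F p" "set p \<subseteq> {..<n}" "n < length p + 2 * k"
  shows "maker_wins n k (Suc X) F R"
proof (rule maker_wins_step)
  fix R' assume R': "R \<subseteq> R'" "R' \<inter> F = {}" "pseudorandom_complement n k R'"
  let ?m = "length p"
  have "\<exists>a\<in>set (take k p). \<exists>b\<in>set (drop (?m - k) p). {a, b} \<notin> R'"
  proof -
    have d: "distinct p" using assms by simp
    have "set (take k p) \<inter> set (drop (?m - k) p) = {}"
      using d n assms(5) by (intro set_take_disj_set_drop_if_distinct) auto
    moreover have "set (take k p) \<subseteq> {..<n}" "set (drop (?m - k) p) \<subseteq> {..<n}"
      using assms(4) set_take_subset[of k p] set_drop_subset[of "?m - k" p] by auto
    moreover have "card (set (take k p)) = k" "card (set (drop (?m - k) p)) = k"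
      using d n assms(5) by (auto simp: distinct_card)
    ultimately show ?thesis
      using pseudorandom_complementD[OF R'(3)] by (metis order_refl)
  qed
  then obtain a b where ab: "a \<in> set (take k p)" "b \<in> set (drop (?m - k) p)" "{a, b} \<notin> R'"
    by blast
  from ab(1) obtain i where i: "i < k" "p ! i = a" by (auto simp: in_set_conv_nth)
  from ab(2) obtain j' where "j' < length (drop (?m - k) p)" "drop (?m - k) p ! j' = b"
    by (auto simp: in_set_conv_nth)
  then have "?m - k + j' < ?m" "p ! (?m - k + j') = b" by auto
  with i ab(3) obtain j where ij: "i < k" "?m - k \<le> j" "j < ?m" "{p ! i, p ! j} \<notin> R'"
    by (metis le_add1)
  then have lt: "i < j" using n assms(5) by linarith
  \<comment> \<open>Fewer than \<open>k\<close> vertices are cut off at either end, which gives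
    \<open>n < length c + 4 * k\<close>.\<close>
  define c where "c = drop i (take (Suc j) p)"
  have p: "p = take i p @ c @ drop (Suc j) p"
    using lt ij unfolding c_def
    by (metis append.assoc append_take_drop_id less_SucI less_imp_le_nat min.absorb1 take_take)
  have len: "length c = Suc j - i" using ij by (simp add: c_def)
  have c: "is_path F c" "set c \<subseteq> {..<n}"
  proof -
    have "is_path F (take i p @ c @ drop (Suc j) p)" "set (take i p @ c @ drop (Suc j) p) \<subseteq> {..<n}"
      using p assms by metis+
    then show "is_path F c" "set c \<subseteq> {..<n}" by (auto simp: successively_append_iff)
  qed
  have "hd c = p ! i" "last c = p ! j"
    using lt ij len by (auto simp: c_def hd_drop_conv_nth last_conv_nth)
  then have "is_cycle (insert {p ! i, p ! j} F) c"
    using c(1) successively_insert[of F c "{p ! i, p ! j}"] len ij n assms(5)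
    by (auto simp: is_cycle_def insert_commute)
  then have "maker_wins n k X (insert {p ! i, p ! j} F) R'"
    using ij R' c len n assms(5) by (intro cont) auto
  moreover have "{p ! i, p ! j} \<in> complete_edges n"
  proof (rule edge_in_complete_edges)
    show "p ! i \<noteq> p ! j" using assms(3) ij lt by (simp add: nth_eq_iff_index_eq)
    show "p ! i < n" "p ! j < n"
      using subsetD[OF assms(4) nth_mem, of i] subsetD[OF assms(4) nth_mem, of j] ij lt by auto
  qed
  ultimately show "maker_wins n k X F R' \<or>
      (\<exists>e\<in>complete_edges n - R'. maker_wins n k X (insert e F) R')"
    using ij by blast
qed

section \<open>Absorbing the vertices off the cycle\<close>

text \<open>A rotation: the new cycle runs from \<open>c ! i\<close> through \<open>v\<close> to
  \<open>c ! j\<close>, backwards to \<open>c ! Suc i\<close>, and then jumps to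
  \<open>c ! Suc j\<close>. As \<open>Suc j < length c\<close>, the closing edge survives.\<close>

lemma is_cycle_insert_vertex:
  assumes c: "is_cycle F c" and v: "v \<notin> set c" and ij: "i < j" "Suc j < length c"
    and e: "{v, c ! i} \<in> F" "{v, c ! j} \<in> F" "{c ! Suc i, c ! Suc j} \<in> F"
  obtains c' where "is_cycle F c'" "set c' = insert v (set c)"
proof -
  define X where "X = take (Suc i) c"
  define Y where "Y = drop (Suc i) (take (Suc j) c)"
  define Z where "Z = drop (Suc j) c"
  have cXYZ: "c = X @ Y @ Z"
    unfolding X_def Y_def Z_def
    by (metis append.assoc append_take_drop_id ij(1) less_imp_le_nat Suc_le_mono min.absorb1 take_take)
  have ne: "X \<noteq> []" "Y \<noteq> []" "Z \<noteq> []" using ij by (auto simp: X_def Y_def Z_def)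
  have ends: "last X = c ! i" "hd Y = c ! Suc i" "last Y = c ! j" "hd Z = c ! Suc j"
    using ij ne by (auto simp: X_def Y_def Z_def last_conv_nth hd_drop_conv_nth)
  let ?c = "X @ [v] @ rev Y @ Z"
  have c0: "is_path F (X @ Y @ Z)" "{last (X @ Y @ Z), hd (X @ Y @ Z)} \<in> F" "length (X @ Y @ Z) \<ge> 3"
    using c cXYZ by (auto simp: is_cycle_def)
  have "successively (\<lambda>x y. {x, y} \<in> F) (rev Y)"
    using c0(1) by (simp add: successively_append_iff insert_commute)
  then have "is_cycle F ?c"
    using c0 ne v e ends cXYZ
    by (auto simp: is_cycle_def successively_append_iff successively_Cons hd_append hd_rev last_rev
        insert_commute)
  moreover have "set ?c = insert v (set c)" using cXYZ by auto
  ultimately show ?thesis using that by blast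
qed

text \<open>\<open>butlast\<close> leaves out the one vertex without a successor in the list, so
  that the rotation never wraps around. At most \<open>m\<close> neighbours of \<open>v\<close> are
  still missing.\<close>

lemma maker_wins_by_star:
  assumes cont: "\<And>F R. R \<inter> F = {} \<Longrightarrow> is_cycle F c \<Longrightarrow>
      2 * k \<le> card {x \<in> set (butlast c). {v, x} \<in> F} \<Longrightarrow> maker_wins n k X F R"
    and c: "set c \<subseteq> {..<n}" "n \<le> length c + 4 * k" and v: "v < n" "v \<notin> set c"
  shows "R \<inter> F = {} \<Longrightarrow> is_cycle F c \<Longrightarrow> 2 * k \<le> card {x \<in> set (butlast c). {v, x} \<in> F} + m \<Longrightarrow>
    maker_wins n k (m + X) F R"
proof (induction m arbitrary: F R)
  case 0
  then show ?case using cont by simp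
next
  case (Suc m)
  let ?N = "\<lambda>F. {x \<in> set (butlast c). {v, x} \<in> F}"
  have "maker_wins n k (Suc (m + X)) F R"
  proof (rule maker_wins_step)
    fix R' assume R': "R \<subseteq> R'" "R' \<inter> F = {}" "pseudorandom_complement n k R'"
    show "maker_wins n k (m + X) F R' \<or>
          (\<exists>e\<in>complete_edges n - R'. maker_wins n k (m + X) (insert e F) R')"
    proof (cases "2 * k \<le> card (?N F) + m")
      case True
      then show ?thesis using Suc R' by auto
    next
      case False
      then have small: "card (?N F) < 2 * k" by simp
      let ?G = "{x \<in> {..<n} - {v}. {v, x} \<notin> R'}"
      have "6 * k < card ?G" using R'(3) v by (simp add: pseudorandom_complement_def)
      \<comment> \<open>If Breaker held all edges from \<open>v\<close> to the rest of
        \<open>butlast c\<close>, the more than \<open>6 * k\<close> vertices of \<open>?G\<close>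
        would fit into a set of at most \<open>6 * k\<close> vertices.\<close>
      have "?G \<subseteq> (?N F) \<union> insert (last c) ({..<n} - set c)" if "\<forall>x \<in> set (butlast c) - ?N F. {v, x} \<in> R'"
      proof
        fix x assume x: "x \<in> ?G"
        show "x \<in> (?N F) \<union> insert (last c) ({..<n} - set c)"
        proof (cases "x \<in> set c")
          case True
          then have "x \<in> set (butlast c) \<or> x = last c"
            by (metis append_butlast_last_id empty_iff in_set_conv_decomp_last list.set(1) set_ConsD
                Un_iff set_append)
          then show ?thesis using that x by blast
        qed (use x in auto)
      qed
      moreover have "card ((?N F) \<union> insert (last c) ({..<n} - set c)) \<le> 6 * k"
      proof -
        have d: "card (set c) = length c" using Suc.prems by (auto simp: is_cycle_def distinct_card)
        have "card ({..<n} - set c) \<le> 4 * k" using c d by (subst card_Diff_subset) auto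
        moreover have "card (insert (last c) ({..<n} - set c)) \<le> Suc (card ({..<n} - set c))"
          by (rule card_insert_le_m1) auto
        moreover have "card ((?N F) \<union> insert (last c) ({..<n} - set c)) \<le>
            card (?N F) + card (insert (last c) ({..<n} - set c))" by (rule card_Un_le)
        ultimately show ?thesis using small by linarith
      qed
      ultimately obtain x where x: "x \<in> set (butlast c)" "{v, x} \<notin> F" "{v, x} \<notin> R'"
        using \<open>6 * k < card ?G\<close> card_mono[of "(?N F) \<union> insert (last c) ({..<n} - set c)" ?G]
        by fastforce
      have xc: "x \<in> set c" using x(1) by (rule in_set_butlastD)
      have "card (?N (insert {v, x} F)) \<ge> Suc (card (?N F))"
      proof -
        have "insert x (?N F) \<subseteq> ?N (insert {v, x} F)" using x by auto
        then have "card (insert x (?N F)) \<le> card (?N (insert {v, x} F))"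
          by (intro card_mono) auto
        then show ?thesis using x by simp
      qed
      moreover have "is_cycle (insert {v, x} F) c" using Suc.prems(2) is_cycle_mono by blast
      ultimately have "maker_wins n k (m + X) (insert {v, x} F) R'"
        using Suc.prems R' x by (intro Suc.IH) auto
      moreover have "{v, x} \<in> complete_edges n"
        using c v xc by (intro edge_in_complete_edges) auto
      ultimately show ?thesis using x by blast
    qed
  qed
  then show ?case by simp
qed

lemma maker_wins_by_insertion:
  assumes cont: "\<And>c' F R. R \<inter> F = {} \<Longrightarrow> is_cycle F c' \<Longrightarrow> set c' = insert v (set c) \<Longrightarrow>
      maker_wins n k X F R"
    and c: "set c \<subseteq> {..<n}" "n \<le> length c + 4 * k" and v: "v < n" "v \<notin> set c"
    and F: "R \<inter> F = {}" "is_cycle F c"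
  shows "maker_wins n k (2 * k + Suc X) F R"
proof (rule maker_wins_by_star[OF _ c v F])
  show "2 * k \<le> card {x \<in> set (butlast c). {v, x} \<in> F} + 2 * k" by simp
next
  fix F R assume F: "R \<inter> F = {}" "is_cycle F c" "2 * k \<le> card {x \<in> set (butlast c). {v, x} \<in> F}"
  have d: "distinct c" using F(2) by (simp add: is_cycle_def)
  define I where "I = {i. Suc i < length c \<and> {v, c ! i} \<in> F}"
  have finI: "finite I" by (rule finite_subset[of _ "{..<length c}"]) (auto simp: I_def)
  have "{x \<in> set (butlast c). {v, x} \<in> F} \<subseteq> (!) c ` I"
    by (auto simp: I_def in_set_conv_nth nth_butlast)
  then have "card {x \<in> set (butlast c). {v, x} \<in> F} \<le> card I"
    using finI surj_card_le by blast
  with F(3) have "2 * k \<le> card I" by simp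
  \<comment> \<open>Splitting the neighbours into two halves yields two disjoint sets of successors,
    between which pseudorandomness supplies a chord that is not Breaker's.\<close>
  then obtain I1 where I1: "I1 \<subseteq> I" "card I1 = k" using obtain_subset_with_card_n[of k I] by auto
  define I2 where "I2 = I - I1"
  have I2: "k \<le> card I2" using I1 finI \<open>2 * k \<le> card I\<close> unfolding I2_def
    by (subst card_Diff_subset) (auto intro: finite_subset)
  let ?s = "\<lambda>i. c ! Suc i"
  have inj: "inj_on ?s I" using d by (auto simp: I_def inj_on_def nth_eq_iff_index_eq)
  have sub: "?s ` I \<subseteq> {..<n}" using c(1) by (auto simp: I_def subset_iff)
  show "maker_wins n k (Suc X) F R"
  proof (rule maker_wins_step)
    fix R' assume R': "R \<subseteq> R'" "R' \<inter> F = {}" "pseudorandom_complement n k R'"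
    have "\<exists>a\<in>?s ` I1. \<exists>b\<in>?s ` I2. {a, b} \<notin> R'"
    proof (rule pseudorandom_complementD[OF R'(3)])
      show "?s ` I1 \<subseteq> {..<n}" "?s ` I2 \<subseteq> {..<n}" using sub I1 I2_def by auto
      show "?s ` I1 \<inter> ?s ` I2 = {}"
        using inj_on_image_Int[OF inj I1(1), of I2] by (auto simp: I2_def)
      have "card (?s ` I1) = card I1" "card (?s ` I2) = card I2"
        using inj I1 by (auto intro!: card_image inj_on_subset[OF inj] simp: I2_def)
      then show "k \<le> card (?s ` I1)" "k \<le> card (?s ` I2)" using I1 I2 by auto
    qed blast
    then obtain i j where "i \<in> I" "j \<in> I" "i \<noteq> j" "{?s i, ?s j} \<notin> R'"
      using I1(1) by (auto simp: I2_def)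
    then obtain i j where ij: "i \<in> I" "j \<in> I" "i < j" "{?s i, ?s j} \<notin> R'"
      by (metis insert_commute linorder_neqE_nat)
    let ?F = "insert {?s i, ?s j} F"
    obtain c' where "is_cycle ?F c'" "set c' = insert v (set c)"
    proof (rule is_cycle_insert_vertex)
      show "is_cycle ?F c" using F(2) is_cycle_mono by blast
    qed (use ij v in \<open>auto simp: I_def\<close>)
    then have "maker_wins n k X ?F R'" using ij R' by (intro cont) auto
    moreover have "{?s i, ?s j} \<in> complete_edges n"
    proof (rule edge_in_complete_edges)
      show "?s i \<noteq> ?s j" using inj ij by (auto dest: inj_onD)
    qed (use sub ij in auto)
    ultimately show "maker_wins n k X F R' \<or>
        (\<exists>e\<in>complete_edges n - R'. maker_wins n k X (insert e F) R')"
      using ij by blast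
  qed
qed

text \<open>Each vertex off the cycle costs \<open>2 * k\<close> rounds for the star and one for the
  chord. The bound \<open>m \<le> 4 * k\<close> keeps \<open>maker_wins_by_insertion\<close>
  applicable.\<close>

lemma maker_wins_by_insertions:
  "R \<inter> F = {} \<Longrightarrow> is_cycle F c \<Longrightarrow> set c \<subseteq> {..<n} \<Longrightarrow> n \<le> length c + m \<Longrightarrow> m \<le> 4 * k \<Longrightarrow>
    maker_wins n k (m * (2 * k + 1)) F R"
proof (induction m arbitrary: F R c)
  case 0
  then have "card (set c) \<ge> card {..<n}" by (simp add: is_cycle_def distinct_card)
  then have "set c = {..<n}" using 0 card_seteq[of "{..<n}" "set c"] by auto
  then have "contains_hamilton_cycle n F" using 0 contains_hamilton_cycle_if_is_cycle by blast
  then show ?case by (simp add: maker_goal_def)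
next
  case (Suc m)
  show ?case
  proof (cases "set c = {..<n}")
    case True
    then have "contains_hamilton_cycle n F" 
      using contains_hamilton_cycle_if_is_cycle[OF Suc.prems(2)] by simp
    then show ?thesis by (intro maker_wins_if_goal) (simp add: maker_goal_def)
  next
    case False
    then obtain v where v: "v < n" "v \<notin> set c" using Suc.prems by auto
    have "maker_wins n k (2 * k + Suc (m * (2 * k + 1))) F R"
    proof (rule maker_wins_by_insertion[where c = c and v = v])
      fix c' F R assume *: "R \<inter> F = {}" "is_cycle F c'" "set c' = insert v (set c)"
      have "length c' = Suc (length c)"
        using * Suc.prems v distinct_card[of c'] distinct_card[of c] by (simp add: is_cycle_def)
      then show "maker_wins n k (m * (2 * k + 1)) F R"
        using * Suc.prems v by (intro Suc.IH[of _ _ c']) auto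
    qed (use v Suc.prems in auto)
    then show ?thesis by (simp add: algebra_simps)
  qed
qed

text \<open>The budget is \<open>n - k\<close> rounds of search, one to close the cycle, and at most
  \<open>4 * k\<close> insertions of \<open>2 * k + 1\<close> rounds each.\<close>

lemma maker_wins_empty:
  assumes "4 * k + 2 \<le> n" "n + 8 * k^2 + 4 * k + 1 \<le> T"
  shows "maker_wins n k T {} {}"
proof -
  let ?Y = "4 * k * (2 * k + 1)"
  have "maker_wins n k ((n - k) + Suc ?Y) {} {}"
  proof (rule maker_wins_by_path[where p = "[]" and D = "{}" and U = "{..<n}"])
    fix p F R assume *: "R \<inter> F = {}" "is_path F p" "set p \<subseteq> {..<n}" "n < length p + 2 * k"
    show "maker_wins n k (Suc ?Y) F R"
    proof (rule maker_wins_by_cycle)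
      fix c F R
      assume "R \<inter> F = {}" "is_cycle F c" "set c \<subseteq> {..<n}" "n < length c + 4 * k"
      then show "maker_wins n k ?Y F R" by (intro maker_wins_by_insertions) auto
    qed (use * assms in auto)
  qed (use assms in auto)
  then show ?thesis
    by (rule maker_wins_mono_time[rotated])
       (use assms in \<open>simp add: algebra_simps power2_eq_square\<close>)
qed

section \<open>Breaker's random edges\<close>

text \<open>Divided by \<open>M choose b\<close>, the left side is the chance that a random
  \<open>b\<close>-subset of an \<open>M\<close>-set contains \<open>a\<close> given elements. It is
  a product of factors \<open>(b - i) / (M - i)\<close>, each at most \<open>b / M\<close>.\<close>

lemma choose_diff_le:
  assumes "a \<le> b" "b \<le> M"
  shows "real ((M - a) choose (b - a)) \<le> (real b / real M) ^ a * real (M choose b)"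
  using assms(1)
proof (induction a)
  case (Suc a)
  then have a: "a < b" by simp
  have "(b - a) * ((M - a) choose (b - a)) = (M - a) * ((M - Suc a) choose (b - Suc a))"
    using binomial_absorption[of "b - Suc a" "M - a"] a by (simp add: Suc_diff_Suc)
  then have eq: "real (b - a) * real ((M - a) choose (b - a)) =
      real (M - a) * real ((M - Suc a) choose (b - Suc a))"
    by (metis of_nat_mult)
  have pos: "real (M - a) > 0" "real M > 0" using a assms by auto
  have "real ((M - Suc a) choose (b - Suc a)) =
      real (b - a) / real (M - a) * real ((M - a) choose (b - a))"
    using eq pos by (simp add: field_simps)
  also have "\<dots> \<le> real b / real M * real ((M - a) choose (b - a))"
  proof (rule mult_right_mono)
    have "real b * real a \<le> real M * real a" using assms by (intro mult_right_mono) auto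
    then show "real (b - a) / real (M - a) \<le> real b / real M"
      using pos a assms by (simp add: divide_simps of_nat_diff algebra_simps)
  qed simp
  also have "\<dots> \<le> real b / real M * ((real b / real M) ^ a * real (M choose b))"
    using Suc.IH a by (intro mult_left_mono) auto
  finally show ?case by (simp add: mult.assoc)
qed simp

lemma prob_subset_random_subset:
  assumes U: "finite U" "b \<le> card U" and A: "finite A"
  shows "measure_pmf.prob (pmf_of_set {B. B \<subseteq> U \<and> card B = b}) {B. A \<subseteq> B} \<le>
    (real b / real (card U)) ^ card A"
proof -
  let ?K = "{B. B \<subseteq> U \<and> card B = b}"
  have fin: "finite ?K" by (rule finite_subset[of _ "Pow U"]) (use U in auto)
  have cardK: "card ?K = card U choose b" using n_subsets[OF U(1)] by simp
  then have pos: "card ?K > 0" using U by simp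
  then have ne: "?K \<noteq> {}" by force
  have "real (card (?K \<inter> {B. A \<subseteq> B})) \<le> (real b / real (card U)) ^ card A * real (card ?K)"
  proof (cases "A \<subseteq> U \<and> card A \<le> b")
    case True
    have "?K \<inter> {B. A \<subseteq> B} \<subseteq> (\<union>) A ` {C. C \<subseteq> U - A \<and> card C = b - card A}"
    proof
      fix B assume "B \<in> ?K \<inter> {B. A \<subseteq> B}"
      then have B: "B \<subseteq> U" "card B = b" "A \<subseteq> B" by auto
      then have "card (B - A) = b - card A" using A by (simp add: card_Diff_subset)
      then show "B \<in> (\<union>) A ` {C. C \<subseteq> U - A \<and> card C = b - card A}"
        using B by (intro image_eqI[of _ _ "B - A"]) auto
    qed
    moreover have "finite {C. C \<subseteq> U - A \<and> card C = b - card A}"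
      by (rule finite_subset[of _ "Pow U"]) (use U in auto)
    ultimately have "card (?K \<inter> {B. A \<subseteq> B}) \<le> card {C. C \<subseteq> U - A \<and> card C = b - card A}"
      by (rule surj_card_le[rotated])
    also have "\<dots> = (card U - card A) choose (b - card A)"
      using n_subsets[of "U - A"] U A True by (simp add: card_Diff_subset)
    finally have "real (card (?K \<inter> {B. A \<subseteq> B})) \<le> real ((card U - card A) choose (b - card A))"
      by simp
    also have "\<dots> \<le> (real b / real (card U)) ^ card A * real (card U choose b)"
      using choose_diff_le True U by blast
    finally show ?thesis using cardK by simp
  next
    case False
    have "?K \<inter> {B. A \<subseteq> B} = {}"
      using False U by (auto dest: card_mono[rotated] finite_subset)
    then show ?thesis by simp
  qed
  then show ?thesis
    using measure_pmf_of_set[OF ne fin] pos by (simp add: divide_le_eq)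
qed

text \<open>Equality would hold if each element of \<open>S\<close> lay in \<open>B\<close>
  independently with probability \<open>r\<close>. The elements are dependent, but the expansion
  over events \<open>A \<subseteq> B\<close> has nonnegative coefficients, so upper bounds for these
  events suffice.\<close>

lemma expectation_power_card_diff_random_subset:
  fixes x r :: real
  assumes U: "finite U" "real b \<le> r * real (card U)" and S: "finite S"
    and x: "0 \<le> x" "x \<le> 1" and r: "0 \<le> r" "r \<le> 1"
  shows "measure_pmf.expectation (pmf_of_set {B. B \<subseteq> U \<and> card B = b}) (\<lambda>B. (1 - x) ^ card (S - B))
     \<le> (1 - x * (1 - r)) ^ card S"
proof -
  let ?p = "pmf_of_set {B. B \<subseteq> U \<and> card B = b}"
  have "r * real (card U) \<le> 1 * real (card U)" using r by (intro mult_right_mono) auto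
  then have bU: "b \<le> card U" using U(2) by simp
  have br: "real b / real (card U) \<le> r"
    using U(2) r by (cases "card U = 0") (auto simp: divide_le_eq)
  \<comment> \<open>Each element of \<open>S\<close> contributes \<open>x + (1 - x) = 1\<close> if
    it lies in \<open>B\<close> and \<open>1 - x\<close> otherwise; the product is multiplied
    out.\<close>
  have expand: "(1 - x) ^ card (S - B) =
      (\<Sum>A\<in>Pow S. x ^ card A * (1 - x) ^ card (S - A) * indicator {B. A \<subseteq> B} B)" for B
  proof -
    have "(1 - x) ^ card (S - B) = (\<Prod>e\<in>S - B. 1 - x)" by simp
    also have "\<dots> = (\<Prod>e\<in>S. (if e \<in> B then x else 0) + (1 - x))"
      using S by (intro prod.mono_neutral_cong_left) auto
    also have "\<dots> = (\<Sum>A\<in>Pow S. (\<Prod>e\<in>A. if e \<in> B then x else 0) * (\<Prod>e\<in>S - A. 1 - x))"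
      using S by (rule prod_add)
    also have "\<dots> = (\<Sum>A\<in>Pow S. x ^ card A * (1 - x) ^ card (S - A) * indicator {B. A \<subseteq> B} B)"
    proof (intro sum.cong refl)
      fix A assume "A \<in> Pow S"
      then have "finite A" using S finite_subset by auto
      then have "(\<Prod>e\<in>A. if e \<in> B then x else 0) = x ^ card A * indicator {B. A \<subseteq> B} B"
        by (cases "A \<subseteq> B") (auto simp: subset_iff intro!: prod_zero)
      then show "(\<Prod>e\<in>A. if e \<in> B then x else 0) * (\<Prod>e\<in>S - A. 1 - x) =
          x ^ card A * (1 - x) ^ card (S - A) * indicator {B. A \<subseteq> B} B" by simp
    qed
    finally show ?thesis .
  qed
  have int: "integrable (measure_pmf ?p) (indicator X :: _ \<Rightarrow> real)" for X
    by (rule integrable_real_indicator) (auto simp: measure_pmf.emeasure_finite less_top[symmetric])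
  have "measure_pmf.expectation ?p (\<lambda>B. (1 - x) ^ card (S - B)) =
      (\<Sum>A\<in>Pow S. x ^ card A * (1 - x) ^ card (S - A) * measure_pmf.prob ?p {B. A \<subseteq> B})"
    by (subst Bochner_Integration.integral_cong[OF refl expand],
        subst Bochner_Integration.integral_sum) (auto intro!: integrable_mult_right int)
  also have "\<dots> \<le> (\<Sum>A\<in>Pow S. x ^ card A * (1 - x) ^ card (S - A) * r ^ card A)"
  proof (intro sum_mono mult_left_mono)
    fix A assume "A \<in> Pow S"
    then have "finite A" using S finite_subset by auto
    then have "measure_pmf.prob ?p {B. A \<subseteq> B} \<le> (real b / real (card U)) ^ card A"
      using prob_subset_random_subset U(1) bU by blast
    also have "\<dots> \<le> r ^ card A" using br by (intro power_mono) auto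
    finally show "measure_pmf.prob ?p {B. A \<subseteq> B} \<le> r ^ card A" .
  qed (use x in auto)
  also have "\<dots> = (\<Sum>A\<in>Pow S. (\<Prod>e\<in>A. x * r) * (\<Prod>e\<in>S - A. 1 - x))"
    by (simp add: power_mult_distrib mult_ac)
  also have "\<dots> = (\<Prod>e\<in>S. x * r + (1 - x))" using S by (rule prod_add[symmetric])
  finally show ?thesis by (simp add: algebra_simps)
qed

section \<open>Breaker's edges over the whole game\<close>

lemma finite_set_pmf_random_breaker_game: "finite (set_pmf (random_breaker_game n b \<sigma> t))"
  by (induction t) (auto simp: set_pmf_breaker_moves finite_breaker_moves)

text \<open>The last round is averaged first, given the history before it, and turns
  \<open>x\<close> into \<open>x * (1 - r)\<close>; hence the induction over all \<open>x\<close>.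
  Maker's adaptive replies do no harm, because the bound for one round holds for every unclaimed set
  that is large enough.\<close>

lemma expectation_unclaimed_by_breaker:
  fixes x r :: real
  assumes S: "finite S" and r: "0 \<le> r" "r \<le> 1"
  shows "0 \<le> x \<Longrightarrow> x \<le> 1 \<Longrightarrow>
    (\<And>s h. s < t \<Longrightarrow> h \<in> set_pmf (random_breaker_game n b \<sigma> s) \<Longrightarrow>
       real b \<le> r * real (card (unclaimed n h))) \<Longrightarrow>
    measure_pmf.expectation (random_breaker_game n b \<sigma> t) (\<lambda>h. (1 - x) ^ card (S - breaker_edges h))
      \<le> (1 - x * (1 - r) ^ t) ^ card S"
proof (induction t arbitrary: x)
  case 0
  then show ?case by (simp add: breaker_edges_def)
next
  case (Suc t)
  let ?G = "random_breaker_game n b \<sigma> t"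
  let ?step = "\<lambda>h. pmf_of_set (breaker_moves n b h) \<bind>
     (\<lambda>B. return_pmf (h @ [(B, maker_reply n \<sigma> h B)]))"
  let ?f = "\<lambda>h. (1 - x) ^ card (S - breaker_edges h)"
  have fin: "finite (set_pmf ?G)" by (rule finite_set_pmf_random_breaker_game)
  have step: "measure_pmf.expectation (?step h) ?f \<le> (1 - x * (1 - r)) ^ card (S - breaker_edges h)"
    if h: "h \<in> set_pmf ?G" for h
  proof -
    have b: "real b \<le> r * real (card (unclaimed n h))" using Suc.prems(3)[of t h] h by simp
    have "r * real (card (unclaimed n h)) \<le> 1 * real (card (unclaimed n h))"
      using r by (intro mult_right_mono) auto
    with b have "b \<le> card (unclaimed n h)" by simp
    then have moves: "breaker_moves n b h = {B. B \<subseteq> unclaimed n h \<and> card B = b}"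
      by (simp add: breaker_moves_def)
    have "?step h = map_pmf (\<lambda>B. h @ [(B, maker_reply n \<sigma> h B)]) (pmf_of_set (breaker_moves n b h))"
      by (simp add: map_pmf_def)
    then have "measure_pmf.expectation (?step h) ?f = measure_pmf.expectation
        (pmf_of_set {B. B \<subseteq> unclaimed n h \<and> card B = b}) (\<lambda>B. (1 - x) ^ card (S - breaker_edges h - B))"
      by (simp add: moves breaker_edges_snoc Diff_Un Diff_eq Int_assoc)
    also have "\<dots> \<le> (1 - x * (1 - r)) ^ card (S - breaker_edges h)"
      using S Suc.prems r b finite_unclaimed
      by (intro expectation_power_card_diff_random_subset) auto
    finally show ?thesis .
  qed
  have "measure_pmf.expectation (random_breaker_game n b \<sigma> (Suc t)) ?f =
      (\<Sum>h\<in>set_pmf ?G. pmf ?G h * measure_pmf.expectation (?step h) ?f)"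
    unfolding random_breaker_game.simps
    by (subst pmf_expectation_bind[OF fin])
       (auto simp: set_pmf_breaker_moves finite_breaker_moves)
  also have "\<dots> \<le> (\<Sum>h\<in>set_pmf ?G. pmf ?G h * (1 - x * (1 - r)) ^ card (S - breaker_edges h))"
    using step by (intro sum_mono mult_left_mono) auto
  also have "\<dots> = measure_pmf.expectation ?G (\<lambda>h. (1 - x * (1 - r)) ^ card (S - breaker_edges h))"
    by (subst integral_measure_pmf_real[OF fin]) (auto simp: mult.commute)
  also have "\<dots> \<le> (1 - x * (1 - r) * (1 - r) ^ t) ^ card S"
  proof (rule Suc.IH)
    show "0 \<le> x * (1 - r)" "x * (1 - r) \<le> 1" using Suc.prems r by (auto intro: mult_le_one)
    show "real b \<le> r * real (card (unclaimed n h))"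
      if "s < t" "h \<in> set_pmf (random_breaker_game n b \<sigma> s)" for s h
      using Suc.prems(3)[of s h] that by simp
  qed
  finally show ?case by (simp add: mult.assoc)
qed

text \<open>This is the case \<open>x = 1\<close>: since \<open>0 ^ 0 = 1\<close>, the power of
  \<open>1 - x\<close> becomes the indicator of the event.\<close>

lemma prob_subset_breaker_edges:
  fixes r :: real
  assumes S: "finite S" and r: "0 \<le> r" "r \<le> 1"
    and b: "\<And>s h. s < t \<Longrightarrow> h \<in> set_pmf (random_breaker_game n b \<sigma> s) \<Longrightarrow>
       real b \<le> r * real (card (unclaimed n h))"
  shows "measure_pmf.prob (random_breaker_game n b \<sigma> t) {h. S \<subseteq> breaker_edges h}
    \<le> (1 - (1 - r) ^ t) ^ card S"
proof -
  have ind: "(indicator {h. S \<subseteq> breaker_edges h} :: history \<Rightarrow> real) =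
      (\<lambda>h. (1 - 1) ^ card (S - breaker_edges h))"
  proof
    fix h
    have "card (S - breaker_edges h) = 0 \<longleftrightarrow> S \<subseteq> breaker_edges h" using S by auto
    then show "indicator {h. S \<subseteq> breaker_edges h} h =
        ((1 :: real) - 1) ^ card (S - breaker_edges h)"
      by (simp add: indicator_def power_0_left)
  qed
  have "measure_pmf.prob (random_breaker_game n b \<sigma> t) {h. S \<subseteq> breaker_edges h} =
      measure_pmf.expectation (random_breaker_game n b \<sigma> t) (indicator {h. S \<subseteq> breaker_edges h})"
    by simp
  also have "\<dots> = measure_pmf.expectation (random_breaker_game n b \<sigma> t)
      (\<lambda>h. (1 - 1) ^ card (S - breaker_edges h))"
    unfolding ind ..
  also have "\<dots> \<le> (1 - 1 * (1 - r) ^ t) ^ card S"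
    using b by (intro expectation_unclaimed_by_breaker[OF S r]) auto
  finally show ?thesis by simp
qed

section \<open>The union bound for pseudorandomness\<close>

lemma prob_Ex_subset_breaker_edges:
  fixes r :: real
  assumes I: "finite I" "card I \<le> N" and S: "\<And>i. i \<in> I \<Longrightarrow> finite (S i)" "\<And>i. i \<in> I \<Longrightarrow> m \<le> card (S i)"
    and r: "0 \<le> r" "r \<le> 1"
    and b: "\<And>s h. s < t \<Longrightarrow> h \<in> set_pmf (random_breaker_game n b \<sigma> s) \<Longrightarrow>
       real b \<le> r * real (card (unclaimed n h))"
  shows "measure_pmf.prob (random_breaker_game n b \<sigma> t) {h. \<exists>i\<in>I. S i \<subseteq> breaker_edges h}
    \<le> real N * (1 - (1 - r) ^ t) ^ m"
proof -
  let ?P = "measure_pmf.prob (random_breaker_game n b \<sigma> t)"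
  let ?p = "1 - (1 - r) ^ t"
  have p: "0 \<le> ?p" "?p \<le> 1" using r by (auto intro: power_le_one)
  have "{h. \<exists>i\<in>I. S i \<subseteq> breaker_edges h} = (\<Union>i\<in>I. {h. S i \<subseteq> breaker_edges h})" by auto
  then have "?P {h. \<exists>i\<in>I. S i \<subseteq> breaker_edges h} \<le> (\<Sum>i\<in>I. ?P {h. S i \<subseteq> breaker_edges h})"
    using measure_pmf.finite_measure_subadditive_finite[OF I(1)] by simp
  also have "\<dots> \<le> (\<Sum>i\<in>I. ?p ^ m)"
  proof (rule sum_mono)
    fix i assume i: "i \<in> I"
    have "?P {h. S i \<subseteq> breaker_edges h} \<le> ?p ^ card (S i)"
      using prob_subset_breaker_edges[OF S(1)[OF i] r] b by blast
    also have "\<dots> \<le> ?p ^ m" using p S(2)[OF i] by (rule power_decreasing[rotated 1])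
    finally show "?P {h. S i \<subseteq> breaker_edges h} \<le> ?p ^ m" .
  qed
  also have "\<dots> \<le> real N * ?p ^ m" using I p by (simp add: mult_right_mono)
  finally show ?thesis .
qed

lemma card_subsets_le: "k \<le> n \<Longrightarrow> card {A. A \<subseteq> {..<n} \<and> card A = k} \<le> n ^ k"
  using n_subsets[of "{..<n}" k] binomial_le_pow[of k n] by simp

text \<open>The first term is for two disjoint \<open>k\<close>-sets with all \<open>k ^ 2\<close>
  edges between them in Breaker's hands. The second is for a vertex of small degree: Breaker holds
  all its edges except those to some \<open>6 * k\<close> vertices.\<close>

lemma prob_not_pseudorandom_complement:
  fixes r :: real
  assumes n: "6 * k \<le> n" and r: "0 \<le> r" "r \<le> 1"
    and b: "\<And>s h. s < t \<Longrightarrow> h \<in> set_pmf (random_breaker_game n b \<sigma> s) \<Longrightarrow>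
       real b \<le> r * real (card (unclaimed n h))"
  shows "measure_pmf.prob (random_breaker_game n b \<sigma> t)
      {h. \<not> pseudorandom_complement n k (breaker_edges h)}
    \<le> real n ^ (2 * k) * (1 - (1 - r) ^ t) ^ (k ^ 2) +
      real n ^ (6 * k + 1) * (1 - (1 - r) ^ t) ^ (n - 1 - 6 * k)"
proof -
  let ?P = "measure_pmf.prob (random_breaker_game n b \<sigma> t)"
  let ?K = "\<lambda>k. {A. A \<subseteq> {..<n} \<and> card A = k}"
  define I where "I = {(A, B). A \<in> ?K k \<and> B \<in> ?K k \<and> A \<inter> B = {}}"
  define S where "S = (\<lambda>(A, B). (\<lambda>(a, b). {a, b}) ` (A \<times> B) :: edge set)"
  define J where "J = {..<n} \<times> ?K (6 * k)"
  define Q where "Q = (\<lambda>(v, W). (\<lambda>x. {v, x}) ` ({..<n} - {v} - W) :: edge set)"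
  have finK: "finite (?K m)" for m by (rule finite_subset[of _ "Pow {..<n}"]) auto
  have subI: "I \<subseteq> ?K k \<times> ?K k" by (auto simp: I_def)
  have finI: "finite I" using subI finK finite_subset by blast
  have cardI: "card I \<le> n ^ (2 * k)"
  proof -
    have "card I \<le> card (?K k \<times> ?K k)" using subI finK by (intro card_mono) auto
    also have "\<dots> \<le> n ^ k * n ^ k"
      unfolding card_cartesian_product using card_subsets_le[of k n] n by (intro mult_mono) auto
    finally show ?thesis by (simp add: power_add mult_2)
  qed
  have S: "finite (S i)" "k ^ 2 \<le> card (S i)" if iI: "i \<in> I" for i
  proof -
    obtain A B where i: "i = (A, B)" "A \<subseteq> {..<n}" "B \<subseteq> {..<n}" "card A = k" "card B = k" "A \<inter> B = {}"
      using iI by (auto simp: I_def)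
    then have fin: "finite A" "finite B" using finite_subset by blast+
    then show "finite (S i)" by (simp add: S_def i)
    have "inj_on (\<lambda>(a, b). {a, b}) (A \<times> B)"
      using i by (auto simp: inj_on_def doubleton_eq_iff)
    then have "card (S i) = card (A \<times> B)" by (simp add: S_def i card_image)
    then show "k ^ 2 \<le> card (S i)" by (simp add: i card_cartesian_product power2_eq_square)
  qed
  have finJ: "finite J" using finK by (simp add: J_def)
  have cardJ: "card J \<le> n ^ (6 * k + 1)"
    using card_subsets_le[OF n] by (simp add: J_def card_cartesian_product)
  have Q: "finite (Q i)" "n - 1 - 6 * k \<le> card (Q i)" if iJ: "i \<in> J" for i
  proof -
    obtain v W where i: "i = (v, W)" "v < n" "W \<subseteq> {..<n}" "card W = 6 * k"
      using iJ by (auto simp: J_def)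
    then have fin: "finite W" using finite_subset by blast
    show "finite (Q i)" by (simp add: Q_def i)
    have "card (Q i) = card ({..<n} - {v} - W)"
      unfolding Q_def i by (auto intro!: card_image simp: inj_on_def doubleton_eq_iff)
    moreover have "card ({..<n} - {v}) - card W \<le> card ({..<n} - {v} - W)"
      using fin by (rule diff_card_le_card_Diff)
    ultimately show "n - 1 - 6 * k \<le> card (Q i)" using i by simp
  qed
  have "{h. \<not> pseudorandom_complement n k (breaker_edges h)} \<subseteq>
      {h. \<exists>i\<in>I. S i \<subseteq> breaker_edges h} \<union> {h. \<exists>i\<in>J. Q i \<subseteq> breaker_edges h}"
  proof
    fix h assume "h \<in> {h. \<not> pseudorandom_complement n k (breaker_edges h)}"
    then consider A B where "A \<subseteq> {..<n}" "B \<subseteq> {..<n}" "A \<inter> B = {}" "card A = k" "card B = k"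
        "\<forall>a\<in>A. \<forall>b\<in>B. {a, b} \<in> breaker_edges h"
      | v where "v < n" "card {x \<in> {..<n} - {v}. {v, x} \<notin> breaker_edges h} \<le> 6 * k"
      unfolding pseudorandom_complement_def mem_Collect_eq by (metis (lifting) not_le_imp_less)
    then show "h \<in> {h. \<exists>i\<in>I. S i \<subseteq> breaker_edges h} \<union> {h. \<exists>i\<in>J. Q i \<subseteq> breaker_edges h}"
    proof cases
      case 1
      then have "(A, B) \<in> I" "S (A, B) \<subseteq> breaker_edges h" by (auto simp: I_def S_def)
      then show ?thesis by blast
    next
      case 2
      let ?X = "{x \<in> {..<n} - {v}. {v, x} \<notin> breaker_edges h}"
      \<comment> \<open>Padding the exceptional vertices to exactly \<open>6 * k\<close> places the
        pair in \<open>J\<close>.\<close>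
      obtain W where "?X \<subseteq> W" "W \<subseteq> {..<n}" "card W = 6 * k"
        using exists_subset_between[of ?X "6 * k" "{..<n}"] 2 n by auto
      then have "(v, W) \<in> J" "Q (v, W) \<subseteq> breaker_edges h" using 2 by (auto simp: J_def Q_def)
      then show ?thesis by blast
    qed
  qed
  then have "?P {h. \<not> pseudorandom_complement n k (breaker_edges h)} \<le>
      ?P ({h. \<exists>i\<in>I. S i \<subseteq> breaker_edges h} \<union> {h. \<exists>i\<in>J. Q i \<subseteq> breaker_edges h})"
    by (intro measure_pmf.finite_measure_mono) auto
  also have "\<dots> \<le> ?P {h. \<exists>i\<in>I. S i \<subseteq> breaker_edges h} + ?P {h. \<exists>i\<in>J. Q i \<subseteq> breaker_edges h}"
    by (intro measure_Un_le) auto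
  also have "?P {h. \<exists>i\<in>I. S i \<subseteq> breaker_edges h} \<le>
      real (n ^ (2 * k)) * (1 - (1 - r) ^ t) ^ (k ^ 2)"
    using finI cardI S r b by (rule prob_Ex_subset_breaker_edges)
  also have "?P {h. \<exists>i\<in>J. Q i \<subseteq> breaker_edges h} \<le>
      real (n ^ (6 * k + 1)) * (1 - (1 - r) ^ t) ^ (n - 1 - 6 * k)"
    using finJ cardJ Q r b by (rule prob_Ex_subset_breaker_edges)
  finally show ?thesis by simp
qed

text \<open>A round uses up at most \<open>b + 1\<close> edges, possibly fewer when the board runs
  out.\<close>

lemma card_unclaimed_ge:
  assumes "h \<in> set_pmf (random_breaker_game n b \<sigma> t)"
  shows "n choose 2 \<le> card (unclaimed n h) + t * (b + 1)"
proof -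
  have "finite (breaker_edges h) \<and> finite (maker_edges h) \<and>
      card (breaker_edges h) \<le> t * b \<and> card (maker_edges h) \<le> t"
    using assms
  proof (induction t arbitrary: h)
    case 0
    then show ?case by (simp add: breaker_edges_def maker_edges_def)
  next
    case (Suc t)
    then obtain g B where g: "g \<in> set_pmf (random_breaker_game n b \<sigma> t)"
      and B: "B \<in> breaker_moves n b g" and h: "h = g @ [(B, maker_reply n \<sigma> g B)]"
      by (auto simp: set_pmf_breaker_moves)
    have "finite B" "card B \<le> b"
      using B finite_unclaimed finite_subset by (auto simp: breaker_moves_def)
    moreover have "card (breaker_edges g \<union> B) \<le> card (breaker_edges g) + card B"
      by (rule card_Un_le)
    moreover have "card (maker_edges g \<union> set_option m) \<le> Suc (card (maker_edges g))" for m
      by (cases m) (auto intro: card_insert_le_m1)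
    ultimately show ?case
      using Suc.IH[OF g] le_trans by (fastforce simp: h breaker_edges_snoc maker_edges_snoc)
  qed
  moreover have "card (complete_edges n) = n choose 2"
    using n_subsets[of "{..<n}" 2] by (simp add: complete_edges_def)
  moreover have "card (complete_edges n) \<le> card (unclaimed n h) + card (breaker_edges h \<union> maker_edges h)"
    if "finite (breaker_edges h \<union> maker_edges h)"
  proof -
    have "unclaimed n h = complete_edges n - (breaker_edges h \<union> maker_edges h)"
      by (auto simp: unclaimed_def)
    then show ?thesis
      using diff_card_le_card_Diff[OF that, of "complete_edges n"] by simp
  qed
  moreover have "card (breaker_edges h \<union> maker_edges h) \<le> card (breaker_edges h) + card (maker_edges h)"
    by (rule card_Un_le)
  ultimately show ?thesis by simp
qed

section \<open>Hamiltonicity with high probability\<close>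

text \<open>With \<open>L = - ln q\<close> both terms are exponentials. The first exponent,
  \<open>k * (2 * ln n - L * k)\<close>, is eventually at most \<open>- k\<close>; in the second,
  \<open>L * n\<close> dominates \<open>k * ln n\<close>.\<close>

lemma failure_probability_tendsto_0:
  fixes q :: real and k :: "nat \<Rightarrow> nat"
  assumes q: "0 < q" "q < 1"
    and k: "\<And>n. real (k n) \<le> real n powr (1/3)" "\<And>n. real n powr (1/3) - 1 \<le> real (k n)"
  shows "(\<lambda>n. real n ^ (2 * k n) * q ^ ((k n)\<^sup>2) + real n ^ (6 * k n + 1) * q ^ (n - 1 - 6 * k n))
    \<longlonglongrightarrow> 0"
proof -
  define L where "L = - ln q"
  have L: "L > 0" using q by (simp add: L_def)
  have qpow: "q ^ m = exp (- (L * real m))" for m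
    using q by (simp add: L_def exp_of_nat_mult[symmetric] powr_realpow[symmetric] powr_def mult.commute)
  have npow: "real n ^ m = exp (real m * ln (real n))" if "n > 0" for n m
    using that by (simp add: powr_realpow[symmetric] powr_def)
  have "(\<lambda>n. real n ^ (2 * k n) * q ^ ((k n)\<^sup>2)) \<longlonglongrightarrow> 0"
  proof (rule tendsto_sandwich[where f = "\<lambda>_. 0"])
    have "eventually (\<lambda>n. 2 * ln (real n) - L * (real n powr (1/3) - 1) \<le> -1) at_top"
      using L by real_asymp
    then show "eventually (\<lambda>n. real n ^ (2 * k n) * q ^ ((k n)\<^sup>2) \<le> exp (1 - real n powr (1/3))) at_top"
      using eventually_gt_at_top[of 0]
    proof eventually_elim
      case (elim n)
      have "L * (real n powr (1/3) - 1) \<le> L * real (k n)" using L k(2) by (intro mult_left_mono) auto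
      then have "2 * ln (real n) - L * real (k n) \<le> -1" using elim(1) by linarith
      then have "real (k n) * (2 * ln (real n) - L * real (k n)) \<le> real (k n) * (-1)"
        by (intro mult_left_mono) auto
      also have "\<dots> \<le> 1 - real n powr (1/3)" using k(2)[of n] by simp
      finally have "real (k n) * (2 * ln (real n) - L * real (k n)) \<le> 1 - real n powr (1/3)" .
      moreover have "real n ^ (2 * k n) * q ^ ((k n)\<^sup>2) =
          exp (real (k n) * (2 * ln (real n) - L * real (k n)))"
        using elim(2) by (simp add: qpow npow exp_add[symmetric] algebra_simps power2_eq_square)
      ultimately show ?case by simp
    qed
    show "(\<lambda>n. exp (1 - real n powr (1/3))) \<longlonglongrightarrow> 0" by real_asymp
  qed (use q in auto)
  moreover have "(\<lambda>n. real n ^ (6 * k n + 1) * q ^ (n - 1 - 6 * k n)) \<longlonglongrightarrow> 0"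
  proof (rule tendsto_sandwich[where f = "\<lambda>_. 0"])
    let ?g = "\<lambda>n. exp ((6 * real n powr (1/3) + 1) * ln (real n) - L * (real n - 1 - 6 * real n powr (1/3)))"
    show "eventually (\<lambda>n. real n ^ (6 * k n + 1) * q ^ (n - 1 - 6 * k n) \<le> ?g n) at_top"
      using eventually_gt_at_top[of 0]
    proof eventually_elim
      case (elim n)
      have "real n - 1 - 6 * real n powr (1/3) \<le> real (n - 1 - 6 * k n)"
        using k(1)[of n] by linarith
      then have "L * (real n - 1 - 6 * real n powr (1/3)) \<le> L * real (n - 1 - 6 * k n)"
        using L by (intro mult_left_mono) auto
      moreover have "real (6 * k n + 1) * ln (real n) \<le> (6 * real n powr (1/3) + 1) * ln (real n)"
        using k(1)[of n] elim by (intro mult_right_mono) auto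
      moreover have "real n ^ (6 * k n + 1) * q ^ (n - 1 - 6 * k n) =
          exp (real (6 * k n + 1) * ln (real n) - L * real (n - 1 - 6 * k n))"
        unfolding qpow npow[OF elim] by (simp only: mult_exp_exp diff_conv_add_uminus)
      ultimately show ?case by (simp del: of_nat_add of_nat_mult)
    qed
    show "?g \<longlonglongrightarrow> 0" using L by real_asymp
  qed (use q in auto)
  ultimately show ?thesis using tendsto_add by fastforce
qed

lemma ex_maker_strategy: "\<exists>\<sigma>. maker_strategy n \<sigma>"
  unfolding maker_strategy_def
  by (rule exI[of _ "\<lambda>h B. SOME e. e \<in> unclaimed n h - B"]) (simp only: some_in_eq simp_thms)

text \<open>Every reachable history meets the goal, so Maker can fail only where pseudorandomness
  fails.\<close>

lemma hamiltonicity_win_prob_ge: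
  assumes "\<And>h. h \<in> set_pmf (random_breaker_game n b \<sigma> T) \<Longrightarrow>
    maker_goal n k (maker_edges h) (breaker_edges h)"
  shows "1 - measure_pmf.prob (random_breaker_game n b \<sigma> T)
      {h. \<not> pseudorandom_complement n k (breaker_edges h)} \<le> hamiltonicity_win_prob n b \<sigma> T"
proof -
  let ?G = "random_breaker_game n b \<sigma> T"
  have "measure_pmf.prob ?G {h. \<not> contains_hamilton_cycle n (maker_edges h)} \<le>
      measure_pmf.prob ?G {h. \<not> pseudorandom_complement n k (breaker_edges h)}"
    using assms by (intro measure_pmf.finite_measure_mono_AE) (auto simp: AE_measure_pmf_iff maker_goal_def)
  moreover have "measure_pmf.prob ?G {h. \<not> contains_hamilton_cycle n (maker_edges h)} =
      1 - hamiltonicity_win_prob n b \<sigma> T"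
    unfolding hamiltonicity_win_prob_def
    by (subst measure_pmf.prob_compl[symmetric]) (auto intro: arg_cong[where f = "measure _"])
  ultimately show ?thesis by linarith
qed

theorem theorem1p1:
  fixes \<epsilon> :: real and b :: "nat \<Rightarrow> nat"
  assumes "\<epsilon> > 0"
    and "\<And>n. real (b n) \<le> (1 - \<epsilon>) * (real n / 2)"
  shows "\<exists>(\<sigma> :: nat \<Rightarrow> strategy) (\<delta> :: nat \<Rightarrow> real).
           (\<forall>n. maker_strategy n (\<sigma> n)) \<and>
           \<delta> \<in> o(\<lambda>_. 1) \<and>
           (\<lambda>n. hamiltonicity_win_prob n (b n) (\<sigma> n) (nat \<lfloor>(1 + \<delta> n) * real n\<rfloor>))
             \<longlonglongrightarrow> 1"
proof -
  \<comment> \<open>\<open>k ^ 2\<close> must be \<open>o(n)\<close> to keep the extra rounds few,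
    and \<open>k\<close> must outgrow \<open>ln n\<close> for the union bound. The cube root
    satisfies both.\<close>
  define k where "k n = nat \<lfloor>real n powr (1/3)\<rfloor>" for n :: nat
  \<comment> \<open>These are the rounds beyond \<open>n\<close> in
    \<open>maker_wins_empty\<close>.\<close>
  define d where "d n = 8 * (k n)\<^sup>2 + 4 * k n + 1" for n
  define T where "T n = n + d n" for n
  define \<delta> where "\<delta> n = real (d n) / real n" for n
  have k_le: "real (k n) \<le> real n powr (1/3)" for n unfolding k_def by (simp add: of_nat_floor)
  have k_ge: "real n powr (1/3) - 1 \<le> real (k n)" for n
    unfolding k_def using real_of_int_floor_gt_diff_one[of "real n powr (1/3)"] by linarith
  have d_le: "real (d n) \<le> 13 * real n powr (2/3)" if "n \<ge> 1" for n
  proof -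
    let ?y = "real n powr (1/3)"
    have y: "?y \<ge> 1" using that by (simp add: ge_one_powr_ge_zero)
    have y2: "?y\<^sup>2 = real n powr (2/3)" by (simp add: power2_eq_square powr_add[symmetric])
    have "(real (k n))\<^sup>2 \<le> ?y\<^sup>2" using k_le by (intro power_mono) auto
    moreover have "?y \<le> ?y\<^sup>2" using y by (intro self_le_power) auto
    moreover have "real (d n) = 8 * (real (k n))\<^sup>2 + 4 * real (k n) + 1" by (simp add: d_def)
    ultimately have "real (d n) \<le> 13 * ?y\<^sup>2" using y k_le[of n] by linarith
    then show ?thesis using y2 by simp
  qed
  have floor_T: "nat \<lfloor>(1 + \<delta> n) * real n\<rfloor> = T n" if "n \<ge> 1" for n
  proof -
    have "(1 + \<delta> n) * real n = real (T n)" using that by (simp add: \<delta>_def T_def field_simps)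
    then show ?thesis by (simp only: floor_of_nat nat_int)
  qed
  \<comment> \<open>For the small \<open>n\<close> that violate \<open>4 * k n + 2 \<le> n\<close>
    any legal strategy will do.\<close>
  have "\<exists>\<sigma>. maker_strategy n \<sigma> \<and> (4 * k n + 2 \<le> n \<longrightarrow> (\<forall>b h. h \<in> set_pmf (random_breaker_game n b \<sigma> (T n)) \<longrightarrow>
      maker_goal n (k n) (maker_edges h) (breaker_edges h)))" for n
  proof (cases "4 * k n + 2 \<le> n")
    case True
    then have "maker_wins n (k n) (T n) {} {}" by (intro maker_wins_empty) (auto simp: T_def d_def)
    then show ?thesis using strategy_if_maker_wins by metis
  qed (use ex_maker_strategy in auto)
  then obtain \<sigma> where \<sigma>: "\<And>n. maker_strategy n (\<sigma> n)"
    and goal: "\<And>n b h. 4 * k n + 2 \<le> n \<Longrightarrow> h \<in> set_pmf (random_breaker_game n b (\<sigma> n) (T n)) \<Longrightarrow>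
      maker_goal n (k n) (maker_edges h) (breaker_edges h)"
    by metis
  have "\<delta> \<longlonglongrightarrow> 0"
  proof (rule tendsto_sandwich[where f = "\<lambda>_. 0"])
    show "eventually (\<lambda>n. \<delta> n \<le> 13 * real n powr (2/3) / real n) at_top"
      using eventually_ge_at_top[of 1]
      by eventually_elim (use d_le in \<open>auto simp: \<delta>_def intro: divide_right_mono\<close>)
    show "(\<lambda>n. 13 * real n powr (2/3) / real n) \<longlonglongrightarrow> 0" by real_asymp
  qed (auto simp: \<delta>_def)
  then have \<delta>: "\<delta> \<in> o(\<lambda>_. 1)" by (intro smalloI_tendsto) auto
  \<comment> \<open>The exponential is the limit of \<open>(1 - r n) ^ (2 * n)\<close>; half of it
    is eventually a strict lower bound.\<close>
  define q where "q = 1 - exp (- (8 * inverse \<epsilon>)) / 2"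
  have q: "0 < q" "q < 1"
    using assms(1) by (auto simp: q_def intro: less_le_trans[of _ "1::real"])
  \<comment> \<open>This is the quotient of \<open>n / 2\<close>, a bound for \<open>b n\<close>,
    and \<open>\<epsilon> / 8 * n ^ 2\<close>, a lower bound for the number of unclaimed
    edges.\<close>
  define r where "r n = 4 / (\<epsilon> * real n)" for n
  let ?f = "\<lambda>n. real n ^ (2 * k n) * q ^ ((k n)\<^sup>2) + real n ^ (6 * k n + 1) * q ^ (n - 1 - 6 * k n)"
  have "(\<lambda>n. (1 - r n) ^ (2 * n)) \<longlonglongrightarrow> exp (- (8 * inverse \<epsilon>))"
    unfolding r_def using assms(1) by real_asymp
  then have ev_q: "eventually (\<lambda>n. 1 - q < (1 - r n) ^ (2 * n)) at_top"
    by (rule order_tendstoD) (simp add: q_def)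
  \<comment> \<open>After \<open>n\<close> rounds at least
    \<open>\<epsilon> / 2 * n ^ 2 - 3 / 2 * n\<close> edges are left. A quarter of the leading term
    is kept; the rest absorbs the linear term and the extra \<open>d n\<close> rounds.\<close>
  have "eventually (\<lambda>n. 3 / 2 * real n + 13 * real n powr (2/3) * (real n / 2 + 1) \<le>
      3 / 8 * \<epsilon> * (real n)\<^sup>2) at_top"
    using assms(1) by real_asymp
  then have ev_board: "eventually (\<lambda>n. \<epsilon> / 8 * (real n)\<^sup>2 \<le> real n * (real n - 1) / 2 -
      (real n * ((1 - \<epsilon>) * (real n / 2) + 1) + 13 * real n powr (2/3) * (real n / 2 + 1))) at_top"
  proof eventually_elim
    case (elim n)
    have "real n * (real n - 1) / 2 - real n * ((1 - \<epsilon>) * (real n / 2) + 1) =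
        \<epsilon> / 8 * (real n)\<^sup>2 + (3 / 8 * \<epsilon> * (real n)\<^sup>2 - 3 / 2 * real n)"
      by (simp add: field_simps power2_eq_square)
    then show ?case using elim by linarith
  qed
  have ev_k: "eventually (\<lambda>n. 6 * real n powr (1/3) + 2 \<le> real n) at_top" by real_asymp
  have ev_d: "eventually (\<lambda>n. 13 * real n powr (2/3) \<le> real n) at_top" by real_asymp
  have ev_r: "eventually (\<lambda>n. r n \<le> 1) at_top" unfolding r_def using assms(1) by real_asymp
  have lower: "eventually (\<lambda>n. 1 - ?f n \<le>
      hamiltonicity_win_prob n (b n) (\<sigma> n) (nat \<lfloor>(1 + \<delta> n) * real n\<rfloor>)) at_top"
    using eventually_ge_at_top[of 1] ev_q ev_board ev_k ev_d ev_r
  proof eventually_elim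
    case (elim n)
    have k: "6 * k n + 2 \<le> n" using elim(4) k_le[of n] by linarith
    have r: "0 \<le> r n" "r n \<le> 1" using elim assms(1) by (auto simp: r_def)
    \<comment> \<open>A crude bound suffices, since it only affects the constant
      \<open>q\<close>.\<close>
    have T_le: "T n \<le> 2 * n" using elim(5) d_le[OF elim(1)] by (simp add: T_def)
    have b: "real (b n) \<le> r n * real (card (unclaimed n h))"
      if s: "s < T n" and h: "h \<in> set_pmf (random_breaker_game n (b n) (\<sigma> n) s)" for s h
    proof -
      have "\<epsilon> * (real n / 2) \<ge> 0" using assms(1) by simp
      then have b_half: "real (b n) \<le> real n / 2" using assms(2)[of n] by (simp add: algebra_simps)
      have "even (n * (n - 1))" by (cases n) auto
      then have "2 * (n choose 2) = n * (n - 1)"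
        unfolding choose_two by (rule dvd_mult_div_cancel)
      then have "2 * real (n choose 2) = real n * real (n - 1)"
        by (metis of_nat_mult of_nat_numeral)
      then have N: "real (n choose 2) = real n * (real n - 1) / 2"
        using elim(1) by (simp add: of_nat_diff)
      have "s * (b n + 1) \<le> T n * (b n + 1)" using s by (intro mult_right_mono) auto
      then have "n choose 2 \<le> card (unclaimed n h) + T n * (b n + 1)"
        using card_unclaimed_ge[OF h] by linarith
      then have "real (n choose 2) \<le> real (card (unclaimed n h) + T n * (b n + 1))"
        by (rule of_nat_mono)
      then have "real (n choose 2) \<le>
          real (card (unclaimed n h)) + (real n * (real (b n) + 1) + real (d n) * (real (b n) + 1))"
        by (simp add: T_def algebra_simps)
      moreover have "real n * (real (b n) + 1) \<le> real n * ((1 - \<epsilon>) * (real n / 2) + 1)"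
        using assms(2)[of n] by (intro mult_left_mono) auto
      moreover have "real (d n) * (real (b n) + 1) \<le> 13 * real n powr (2/3) * (real n / 2 + 1)"
        using b_half d_le[OF elim(1)] by (intro mult_mono) auto
      ultimately have "\<epsilon> / 8 * (real n)\<^sup>2 \<le> real (card (unclaimed n h))"
        using elim(3) N by linarith
      then have "r n * (\<epsilon> / 8 * (real n)\<^sup>2) \<le> r n * real (card (unclaimed n h))"
        using r by (intro mult_left_mono) auto
      moreover have "r n * (\<epsilon> / 8 * (real n)\<^sup>2) = real n / 2"
        using assms(1) elim(1) by (simp add: r_def power2_eq_square field_simps)
      ultimately show ?thesis using b_half by linarith
    qed
    let ?p = "1 - (1 - r n) ^ T n"
    have "(1 - r n) ^ (2 * n) \<le> (1 - r n) ^ T n" using r T_le by (intro power_decreasing) auto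
    then have p: "?p \<le> q" "0 \<le> ?p" using elim(2) r by (auto intro: power_le_one)
    have "measure_pmf.prob (random_breaker_game n (b n) (\<sigma> n) (T n))
        {h. \<not> pseudorandom_complement n (k n) (breaker_edges h)} \<le>
        real n ^ (2 * k n) * ?p ^ ((k n)\<^sup>2) + real n ^ (6 * k n + 1) * ?p ^ (n - 1 - 6 * k n)"
      using k r b by (intro prob_not_pseudorandom_complement) auto
    also have "\<dots> \<le> ?f n" using p by (intro add_mono mult_left_mono power_mono) auto
    finally have "1 - ?f n \<le> hamiltonicity_win_prob n (b n) (\<sigma> n) (T n)"
      using hamiltonicity_win_prob_ge[OF goal[of n], of "b n"] k by fastforce
    then show ?case using floor_T[OF elim(1)] by simp
  qed
  have "?f \<longlonglongrightarrow> 0" using q k_le k_ge by (rule failure_probability_tendsto_0)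
  then have f: "(\<lambda>n. 1 - ?f n) \<longlonglongrightarrow> 1" using tendsto_diff[OF tendsto_const[of "1::real"]] by fastforce
  have "(\<lambda>n. hamiltonicity_win_prob n (b n) (\<sigma> n) (nat \<lfloor>(1 + \<delta> n) * real n\<rfloor>)) \<longlonglongrightarrow> 1"
    by (rule tendsto_sandwich[OF lower _ f tendsto_const])
       (simp add: hamiltonicity_win_prob_def)
  then show ?thesis using \<sigma> \<delta> by blast
qed

end
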